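(* Let $G$ be a connected graph with $\Delta(G)\geq 2$ and let $\ell(G)$ be the length of the longest path in $G$. Then $$\lambda\big(\mathcal{LM}(G,x)\big)\leq \Delta(G)+2\sqrt{\Delta(G)-1}\,\cos\frac{\pi}{2\ell(G)+2},$$ and equality holds if and only if $G$ is a cycle.
   Context: All graphs are finite, undirected, without loops or multiple edges. $V(G)$ and $E(G)$ are the vertex and edge sets, $d_G(v)$ is the degree of $v$ in $G$, and $\Delta(G)$ is the maximum degree of $G$. The length of a path is its number of edges. A matching of $G$ is a set $M\subseteq E(G)$ (possibly empty) no two distinct edges of which share an endpoint; $V(M)$ is the set of endpoints of edges in $M$. The Laplacian matching polynomial of $G$ is $$\mathcal{LM}(G,x)=\sum_{M}(-1)^{|M|}\prod_{v\in V(G)\setminus V(M)}\big(x-d_G(v)\big),$$ where $M$ ranges over all matchings of $G$. All its roots are known to be real and nonnegative. For a real-rooted polynomial $f(x)$, $\lambda(f(x))$ denotes its largest zero. *)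

theory Defs
  imports
    Complex_Main
    "HOL-Computational_Algebra.Polynomial"
    "Graph_Theory.Graph_Theory"
begin

text \<open>
  A simple graph is a digraph satisfying the locale predicate \<^locale>\<open>graph\<close>: finite, symmetric,
  without loops and without parallel arcs.  An undirected edge is represented there by a pair of
  opposite arcs; \<open>edges G\<close> identifies these two arcs, so that each undirected edge is counted
  once in degrees and in matchings.
\<close>

definition edges :: "('a, 'b) pre_digraph \<Rightarrow> 'a set set" where
  "edges G = {{u, v} | u v. u \<rightarrow>\<^bsub>G\<^esub> v}"

definition vertex_degree :: "('a, 'b) pre_digraph \<Rightarrow> 'a \<Rightarrow> nat" where
  "vertex_degree G v = card {e \<in> edges G. v \<in> e}"

definition max_degree :: "('a, 'b) pre_digraph \<Rightarrow> nat" where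
  "max_degree G = Max (vertex_degree G ` verts G)"

definition longest_path_length :: "('a, 'b) pre_digraph \<Rightarrow> nat" where
  "longest_path_length G = Max {vwalk_length p | p. vpath p G}"

definition is_matching :: "('a, 'b) pre_digraph \<Rightarrow> 'a set set \<Rightarrow> bool" where
  "is_matching G M \<longleftrightarrow> M \<subseteq> edges G \<and> (\<forall>e\<in>M. \<forall>f\<in>M. e \<noteq> f \<longrightarrow> e \<inter> f = {})"

definition laplacian_matching_poly :: "('a, 'b) pre_digraph \<Rightarrow> real poly" where
  "laplacian_matching_poly G =
     (\<Sum>M | is_matching G M.
        (-1) ^ card M * (\<Prod>v\<in>verts G - \<Union>M. [:- real (vertex_degree G v), 1:]))"

text \<open>Meaningful for real-rooted polynomials of positive degree.\<close>

definition largest_zero :: "real poly \<Rightarrow> real" where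
  "largest_zero f = Max {x. poly f x = 0}"

text \<open>
  A whole graph that is a cycle on at least three vertices.  The library predicate
  \<open>pre_digraph.cycle\<close> is about closed walks inside a graph and also admits going back and
  forth along a single edge.
\<close>

definition is_cycle_graph :: "('a, 'b) pre_digraph \<Rightarrow> bool" where
  "is_cycle_graph G \<longleftrightarrow>
     (\<exists>vs. distinct vs \<and> length vs \<ge> 3 \<and> verts G = set vs \<and>
        edges G = {{vs ! i, vs ! (Suc i mod length vs)} | i. i < length vs})"

end

theory Submission
  imports Defs
begin

text \<open>
  Write \<open>f W\<close> for the matching polynomial of the subgraph induced on \<open>W\<close>, with the vertex weights
  \<open>x - d(v)\<close> still taken from the whole graph.  It satisfies
  \<open>f W = (x - d(v)) f(W - v) - \<Sum>u. f(W - v - u)\<close>, summed over the neighbours \<open>u\<close> of \<open>v\<close> in \<open>W\<close>.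
  Let \<open>q = sqrt (\<Delta> - 1)\<close> and \<open>\<theta> = \<pi> / (2 \<ell> + 2)\<close>, and let \<open>x \<ge> \<Delta> + 2 q cos \<theta>\<close>.
  Deleting the vertices of a path \<open>p\<^sub>1, \<dots>, p\<^sub>m\<close> one after the other, every further vertex \<open>v\<close> has at
  most \<open>\<Delta> - 1\<close> neighbours left, and \<open>f W / f(W - v) \<ge> q cos ((m - 1) \<theta>) / cos (m \<theta>)\<close> follows by
  induction, because the right-hand side solves \<open>r\<^sub>m = 2 q cos \<theta> - q\<^sup>2 / r\<^sub>m\<^sub>+\<^sub>1\<close>; as paths have at most
  \<open>\<ell> + 1\<close> vertices, all the cosines involved are nonnegative.  For the first vertex of the
  path, with possibly \<open>\<Delta>\<close> neighbours, the estimate loses something, but positivity survives since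
  \<open>q \<ge> 1 / q\<close>, and it is strict unless \<open>\<Delta> = 2\<close> and the graph is regular, that is, a cycle.
\<close>

section \<open>Neighbourhoods, degrees and paths\<close>

lemma vpath_Cons_iff:
  assumes "p \<noteq> []"
  shows "vpath (u # p) G \<longleftrightarrow>
    u \<in> verts G \<and> u \<notin> set p \<and> u \<rightarrow>\<^bsub>G\<^esub> hd p \<and> vpath p G"
  using assms by (cases p) (auto simp: vpath_def vwalk_def)

lemma vwalk_nth_adj:
  "vwalk p G \<Longrightarrow> Suc i < length p \<Longrightarrow> p ! i \<rightarrow>\<^bsub>G\<^esub> p ! Suc i"
proof (induction p arbitrary: i)
  case (Cons a p)
  then have "p \<noteq> []" by auto
  with Cons.prems have "a \<rightarrow>\<^bsub>G\<^esub> hd p" "vwalk p G"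
    by (auto elim: vwalk_consE)
  with Cons \<open>p \<noteq> []\<close> show ?case by (cases i) (auto simp: hd_conv_nth)
qed auto

lemma vwalkI_nth:
  assumes "p \<noteq> []" "set p \<subseteq> verts G" "\<And>i. Suc i < length p \<Longrightarrow> p ! i \<rightarrow>\<^bsub>G\<^esub> p ! Suc i"
  shows "vwalk p G"
  using assms
proof (induction p)
  case (Cons a p)
  show ?case
  proof (cases "p = []")
    case False
    have "p ! i \<rightarrow>\<^bsub>G\<^esub> p ! Suc i" if "Suc i < length p" for i
      using Cons.prems(3)[of "Suc i"] that by simp
    then have "vwalk p G" using Cons False by auto
    moreover have "a \<rightarrow>\<^bsub>G\<^esub> hd p"
      using Cons.prems(3)[of 0] False by (simp add: hd_conv_nth)
    ultimately show ?thesis using Cons.prems by (auto intro: vwalk_consI)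
  qed (use Cons.prems in \<open>auto simp: vwalk_def\<close>)
qed simp

definition nbrs :: "('a, 'b) pre_digraph \<Rightarrow> 'a \<Rightarrow> 'a set" where
  "nbrs G v = {u. v \<rightarrow>\<^bsub>G\<^esub> u}"

lemma in_nbrs_iff [simp]: "u \<in> nbrs G v \<longleftrightarrow> v \<rightarrow>\<^bsub>G\<^esub> u"
  by (simp add: nbrs_def)

context graph
begin

lemma adj_commute: "u \<rightarrow>\<^bsub>G\<^esub> v \<longleftrightarrow> v \<rightarrow>\<^bsub>G\<^esub> u"
  using arcs_ends_symmetric[OF sym_arcs] by iprover

lemma adj_irrefl: "\<not> u \<rightarrow>\<^bsub>G\<^esub> u"
  using adj_not_same by iprover

lemma doubleton_in_edges_iff: "{u, v} \<in> edges G \<longleftrightarrow> u \<rightarrow>\<^bsub>G\<^esub> v"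
proof
  assume "{u, v} \<in> edges G"
  then obtain a b where "{u, v} = {a, b}" "a \<rightarrow>\<^bsub>G\<^esub> b" unfolding edges_def by blast
  then show "u \<rightarrow>\<^bsub>G\<^esub> v" using adj_commute by (metis doubleton_eq_iff)
qed (auto simp: edges_def)

lemma edgesE:
  assumes "e \<in> edges G" "v \<in> e"
  obtains u where "e = {v, u}" "v \<rightarrow>\<^bsub>G\<^esub> u" "u \<noteq> v"
proof -
  obtain a b where ab: "e = {a, b}" "a \<rightarrow>\<^bsub>G\<^esub> b" using assms(1) unfolding edges_def by blast
  then have "b \<rightarrow>\<^bsub>G\<^esub> a" "a \<noteq> b" using adj_commute[of a b] adj_irrefl[of a] by auto
  with ab assms(2) show ?thesis using that[of a] that[of b] by (metis insertE insert_commute singletonD)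
qed

lemma edges_subset_Pow: "edges G \<subseteq> Pow (verts G)"
  unfolding edges_def using adj_in_verts by blast

lemma finite_edges: "finite (edges G)"
  using edges_subset_Pow by (rule finite_subset) simp

lemma nbrs_subset: "nbrs G v \<subseteq> verts G"
  using adj_in_verts by auto

lemma finite_nbrs [simp]: "finite (nbrs G v)"
  using nbrs_subset by (rule finite_subset) simp

text \<open>An edge at \<open>v\<close> is determined by its other end, so counting undirected edges
  agrees with counting neighbours.\<close>

lemma vertex_degree_eq_card_nbrs: "vertex_degree G v = card (nbrs G v)"
proof -
  have "{e \<in> edges G. v \<in> e} = (\<lambda>u. {v, u}) ` nbrs G v"
    by (auto simp: doubleton_in_edges_iff elim: edgesE)
  moreover have "inj_on (\<lambda>u. {v, u}) (nbrs G v)"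
    by (auto simp: inj_on_def doubleton_eq_iff)
  ultimately show ?thesis
    by (simp add: vertex_degree_def card_image)
qed

lemma vertex_degree_le_max_degree: "v \<in> verts G \<Longrightarrow> vertex_degree G v \<le> max_degree G"
  unfolding max_degree_def by (rule Max_ge) auto

lemma finite_vpath_lengths: "finite {vwalk_length p | p. vpath p G}"
proof -
  have "finite {p. vpath p G}"
    by (rule finite_subset[OF _ finite_subset_distinct[OF finite_verts]]) auto
  then show ?thesis by (simp add: setcompr_eq_image)
qed

lemma vpath_length_le: "vpath p G \<Longrightarrow> length p \<le> Suc (longest_path_length G)"
proof -
  assume p: "vpath p G"
  have "vwalk_length p \<le> longest_path_length G"
    unfolding longest_path_length_def by (rule Max_ge[OF finite_vpath_lengths]) (use p in blast)
  then show ?thesis by simp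
qed

lemma ex_longest_vpath:
  assumes "verts G \<noteq> {}"
  obtains p where "vpath p G" "length p = Suc (longest_path_length G)"
proof -
  obtain v where "v \<in> verts G" using assms by blast
  then have "vpath [v] G" by (auto simp: vpath_def vwalk_def)
  then have "longest_path_length G \<in> {vwalk_length p | p. vpath p G}"
    unfolding longest_path_length_def by (intro Max_in finite_vpath_lengths) blast
  then obtain p where p: "vpath p G" "length p - 1 = longest_path_length G" by auto
  then have "p \<noteq> []" by (auto simp: vpath_def vwalk_def)
  then have "0 < length p" by simp
  with p show ?thesis by (intro that[of p]) linarith+
qed

text \<open>A walk from \<open>W\<close> to a vertex outside has to leave \<open>W\<close>
  somewhere. \<open>connected\<close> speaks of \<open>mk_symmetric G\<close>, which has the same
  reachability as the symmetric digraph \<open>G\<close>.\<close>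

lemma connected_imp_crossing:
  assumes "connected G" "W \<subset> verts G" "W \<noteq> {}"
  obtains v u where "v \<in> W" "u \<in> verts G - W" "v \<rightarrow>\<^bsub>G\<^esub> u"
proof -
  obtain a b where ab: "a \<in> W" "b \<in> verts G" "b \<notin> W" using assms by blast
  have "a \<rightarrow>\<^sup>*\<^bsub>mk_symmetric G\<^esub> b"
    using assms(1,2) ab unfolding connected_def strongly_connected_def
    by (metis psubsetD pverts_mk_symmetric with_proj_simps(1))
  then have "a \<rightarrow>\<^sup>*\<^bsub>G\<^esub> b"
    using reachable_mk_symmetric_eq[OF sym_arcs] by simp
  then have "\<exists>v\<in>W. \<exists>u\<in>verts G - W. v \<rightarrow>\<^bsub>G\<^esub> u"
    using ab(3)
  proof (induction rule: reachable_induct)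
    case base
    with ab show ?case by simp
  next
    case (step x y)
    then show ?case using adj_in_verts(2) by blast
  qed
  then show ?thesis using that by blast
qed

section \<open>Matching polynomials of induced subgraphs\<close>

definition induced_matchings :: "'a set \<Rightarrow> 'a set set set" where
  "induced_matchings W = {M. is_matching G M \<and> \<Union>M \<subseteq> W}"

text \<open>Keeping the degrees of \<open>G\<close> gives each vertex a fixed factor, so that the
  family is closed under the deletion recurrence.\<close>

definition induced_lmp :: "'a set \<Rightarrow> real poly" where
  "induced_lmp W = (\<Sum>M\<in>induced_matchings W.
     (-1) ^ card M * (\<Prod>v\<in>W - \<Union>M. [:- real (vertex_degree G v), 1:]))"

lemma induced_lmp_verts: "induced_lmp (verts G) = laplacian_matching_poly G"
proof -
  have "induced_matchings (verts G) = {M. is_matching G M}"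
    using edges_subset_Pow by (auto simp: induced_matchings_def is_matching_def)
  then show ?thesis by (simp add: induced_lmp_def laplacian_matching_poly_def)
qed

lemma finite_induced_matchings: "finite (induced_matchings W)"
  by (rule finite_subset[of _ "Pow (edges G)"])
    (auto simp: induced_matchings_def is_matching_def finite_edges)

lemma finite_matching: "is_matching G M \<Longrightarrow> finite M"
  using finite_edges finite_subset by (auto simp: is_matching_def)

lemma induced_lmp_empty: "induced_lmp {} = 1"
proof -
  have "induced_matchings {} = {{}}"
    by (auto simp: induced_matchings_def is_matching_def edges_def)
  then show ?thesis by (simp add: induced_lmp_def)
qed

lemma is_matching_insert_iff:
  assumes "{v, u} \<notin> M"
  shows "is_matching G (insert {v, u} M) \<longleftrightarrow>
    v \<rightarrow>\<^bsub>G\<^esub> u \<and> is_matching G M \<and> v \<notin> \<Union>M \<and> u \<notin> \<Union>M"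
  using assms by (fastforce simp: is_matching_def doubleton_in_edges_iff)

text \<open>A matching that covers \<open>v\<close> does so by exactly one edge
  \<open>{v, u}\<close>, and removing it leaves a matching that avoids both ends.\<close>

lemma induced_matchings_at_vertex:
  assumes "v \<in> W"
  shows "induced_matchings W = induced_matchings (W - {v}) \<union>
    (\<Union>u\<in>nbrs G v \<inter> W. insert {v, u} ` induced_matchings (W - {v, u}))" (is "_ = ?R")
proof (intro equalityI subsetI)
  fix M assume M: "M \<in> induced_matchings W"
  show "M \<in> ?R"
  proof (cases "v \<in> \<Union>M")
    case False
    with M show ?thesis by (auto simp: induced_matchings_def)
  next
    case True
    then obtain e where e: "e \<in> M" "v \<in> e" by blast
    with M have "e \<in> edges G" by (auto simp: induced_matchings_def is_matching_def)
    then obtain u where u: "e = {v, u}" "v \<rightarrow>\<^bsub>G\<^esub> u" "u \<noteq> v" using e(2) by (rule edgesE)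
    have eq: "insert {v, u} (M - {e}) = M" using e u by auto
    have "is_matching G (insert {v, u} (M - {e}))"
      using M by (simp add: eq induced_matchings_def)
    then have "is_matching G (M - {e}) \<and> v \<notin> \<Union>(M - {e}) \<and> u \<notin> \<Union>(M - {e})"
      using is_matching_insert_iff[of v u "M - {e}"] u(1) by simp
    with M have "M - {e} \<in> induced_matchings (W - {v, u})"
      by (auto simp: induced_matchings_def)
    then have "M \<in> insert {v, u} ` induced_matchings (W - {v, u})"
      using eq by (metis imageI)
    moreover have "u \<in> W" using M e u by (auto simp: induced_matchings_def)
    ultimately show ?thesis using u by auto
  qed
next
  fix M assume "M \<in> ?R"
  then show "M \<in> induced_matchings W"
  proof
    assume "M \<in> (\<Union>u\<in>nbrs G v \<inter> W. insert {v, u} ` induced_matchings (W - {v, u}))"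
    then obtain u N where u: "v \<rightarrow>\<^bsub>G\<^esub> u" "u \<in> W" and M: "M = insert {v, u} N"
      and N: "N \<in> induced_matchings (W - {v, u})" by auto
    have "{v, u} \<notin> N" using N by (auto simp: induced_matchings_def)
    then show ?thesis
      using is_matching_insert_iff[of v u N] N u M assms by (auto simp: induced_matchings_def)
  qed (auto simp: induced_matchings_def)
qed

text \<open>The matchings are split by what happens at \<open>v\<close>: leaving \<open>v\<close>
  uncovered contributes the factor of \<open>v\<close>, and an edge \<open>{v, u}\<close>
  contributes a sign.\<close>

lemma induced_lmp_recurrence:
  assumes "v \<in> W" "finite W"
  shows "induced_lmp W = [:- real (vertex_degree G v), 1:] * induced_lmp (W - {v})
    - (\<Sum>u\<in>nbrs G v \<inter> W. induced_lmp (W - {v, u}))"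
proof -
  let ?x = "\<lambda>v. [:- real (vertex_degree G v), 1:]"
  let ?g = "\<lambda>W M. (-1) ^ card M * (\<Prod>v\<in>W - \<Union>M. ?x v)"
  let ?I = "\<lambda>u. insert {v, u} ` induced_matchings (W - {v, u})"
  have notin: "{v, u} \<notin> M" if "M \<in> induced_matchings (W - {v, u})" for u M
    using that by (auto simp: induced_matchings_def)
  have disj: "induced_matchings (W - {v}) \<inter> (\<Union>u\<in>nbrs G v \<inter> W. ?I u) = {}"
    by (auto simp: induced_matchings_def)
  \<comment> \<open>A common matching would force \<open>{v, u}\<close> into \<open>N\<close>, whose
    edges avoid \<open>v\<close>.\<close>
  have disj': "?I u \<inter> ?I w = {}" if "u \<noteq> w" for u w
  proof (rule ccontr)
    assume "?I u \<inter> ?I w \<noteq> {}"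
    then obtain M N where *: "M \<in> induced_matchings (W - {v, u})"
      "N \<in> induced_matchings (W - {v, w})" "insert {v, u} M = insert {v, w} N" by blast
    then have "{v, u} \<in> insert {v, w} N" by (metis insertI1)
    moreover have "{v, u} \<noteq> {v, w}" unfolding doubleton_eq_iff using that by blast
    ultimately have "{v, u} \<in> N" by simp
    with *(2) show False by (auto simp: induced_matchings_def)
  qed
  have "induced_lmp W = (\<Sum>M\<in>induced_matchings (W - {v}). ?g W M)
      + (\<Sum>M\<in>(\<Union>u\<in>nbrs G v \<inter> W. ?I u). ?g W M)"
    unfolding induced_lmp_def induced_matchings_at_vertex[OF assms(1)]
    by (rule sum.union_disjoint) (use disj in \<open>auto simp: finite_induced_matchings\<close>)
  also have "(\<Sum>M\<in>induced_matchings (W - {v}). ?g W M) = ?x v * induced_lmp (W - {v})"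
    unfolding induced_lmp_def sum_distrib_left
  proof (rule sum.cong[OF refl])
    fix M assume "M \<in> induced_matchings (W - {v})"
    then have "W - \<Union>M = insert v (W - {v} - \<Union>M)"
      using assms by (auto simp: induced_matchings_def)
    then have "(\<Prod>v\<in>W - \<Union>M. ?x v) = ?x v * (\<Prod>v\<in>W - {v} - \<Union>M. ?x v)"
      using assms(2) by simp
    then show "?g W M = ?x v * ?g (W - {v}) M" by (simp add: mult_ac)
  qed
  also have "(\<Sum>M\<in>(\<Union>u\<in>nbrs G v \<inter> W. ?I u). ?g W M)
      = (\<Sum>u\<in>nbrs G v \<inter> W. \<Sum>M\<in>?I u. ?g W M)"
    by (intro sum.UNION_disjoint ballI impI disj' finite_imageI finite_induced_matchings) auto
  also have "\<dots> = (\<Sum>u\<in>nbrs G v \<inter> W. - induced_lmp (W - {v, u}))"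
  proof (rule sum.cong[OF refl])
    fix u assume u: "u \<in> nbrs G v \<inter> W"
    have inj: "inj_on (insert {v, u}) (induced_matchings (W - {v, u}))"
      by (rule inj_onI) (metis notin insert_ident)
    have "?g W (insert {v, u} M) = - ?g (W - {v, u}) M"
      if M: "M \<in> induced_matchings (W - {v, u})" for M
    proof -
      have "card (insert {v, u} M) = Suc (card M)"
        using M notin by (auto simp: induced_matchings_def finite_matching)
      moreover have "W - \<Union>(insert {v, u} M) = W - {v, u} - \<Union>M" by auto
      ultimately show ?thesis by simp
    qed
    then show "(\<Sum>M\<in>?I u. ?g W M) = - induced_lmp (W - {v, u})"
      by (simp add: sum.reindex[OF inj] induced_lmp_def sum_negf)
  qed
  finally show ?thesis by (simp add: sum_negf)
qed

lemma poly_induced_lmp_recurrence: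
  assumes "v \<in> W" "finite W"
  shows "poly (induced_lmp W) x =
    (x - real (vertex_degree G v)) * poly (induced_lmp (W - {v})) x
    - (\<Sum>u\<in>nbrs G v \<inter> W. poly (induced_lmp (W - {v, u})) x)"
  by (subst induced_lmp_recurrence[OF assms]) (simp add: poly_sum algebra_simps)

section \<open>The largest zero\<close>

text \<open>Positivity and the ratio bound are proved together, as each ratio step multiplies
  inequalities by values on smaller sets. \<open>p\<close> lists deleted vertices, the latest first,
  and \<open>v\<close> extends this path; \<open>W\<close> may lack further vertices as well. Since
  \<open>W\<close> is proper, connectedness gives a nonempty \<open>W\<close> some vertex that has
  already lost a neighbour.\<close>

lemma induced_lmp_pos_ratio:
  fixes q \<theta> x :: real
  assumes conn: "connected G"
    and q: "0 < q" "\<And>v. v \<in> verts G \<Longrightarrow> real (vertex_degree G v) \<le> q\<^sup>2 + 1"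
    and \<theta>: "(real (longest_path_length G) + 1) * \<theta> = pi / 2"
    and x: "q\<^sup>2 + 1 + 2 * q * cos \<theta> \<le> x"
    and W: "W \<subset> verts G"
  shows "0 < poly (induced_lmp W) x \<and>
    (\<forall>v p. v \<in> W \<and> vpath (v # p) G \<and> p \<noteq> [] \<and> set p \<inter> W = {} \<longrightarrow>
      q * cos ((real (length p) - 1) * \<theta>) * poly (induced_lmp (W - {v})) x
        \<le> cos (real (length p) * \<theta>) * poly (induced_lmp W) x)"
proof -
  have \<theta>_pos: "0 < \<theta>"
  proof (rule ccontr)
    assume "\<not> 0 < \<theta>"
    then have "(real (longest_path_length G) + 1) * \<theta> \<le> 0" by (intro mult_nonneg_nonpos) auto
    with \<theta> show False using pi_gt_zero by linarith
  qed
  \<comment> \<open>The angle reaches \<open>pi / 2\<close> exactly at \<ell> + 1, where the cosine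
    vanishes; up to \<ell> it is positive.\<close>
  have cos_nonneg: "0 \<le> cos (real m * \<theta>)" if "m \<le> Suc (longest_path_length G)" for m
  proof (rule cos_ge_zero)
    have "real m * \<theta> \<le> (real (longest_path_length G) + 1) * \<theta>"
      using that \<theta>_pos by (intro mult_right_mono) auto
    then show "real m * \<theta> \<le> pi / 2" using \<theta> by simp
    have "0 \<le> real m * \<theta>" using \<theta>_pos by simp
    then show "- (pi / 2) \<le> real m * \<theta>" using pi_gt_zero by linarith
  qed
  have cos_pos: "0 < cos (real m * \<theta>)" if "m \<le> longest_path_length G" for m
  proof (rule cos_gt_zero_pi)
    have "real m * \<theta> < (real (longest_path_length G) + 1) * \<theta>"
      using that \<theta>_pos by (intro mult_strict_right_mono) auto
    then show "real m * \<theta> < pi / 2" using \<theta> by simp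
    have "0 \<le> real m * \<theta>" using \<theta>_pos by simp
    then show "- (pi / 2) < real m * \<theta>" using pi_gt_zero by linarith
  qed
  have "finite W" using finite_subset[OF psubset_imp_subset[OF W]] by simp
  then show ?thesis using W
  proof (induction W rule: finite_psubset_induct)
    case (psubset W)
    let ?f = "\<lambda>U. poly (induced_lmp U) x"
    have f_pos: "0 < ?f U" if "U \<subset> W" for U
      by (rule conjunct1[OF psubset.IH[OF that psubset_trans[OF that psubset.prems]]])
    have ratio: "q * cos ((real (length p) - 1) * \<theta>) * ?f (W - {v})
        \<le> cos (real (length p) * \<theta>) * ?f W"
      if v: "v \<in> W" and p: "vpath (v # p) G" "p \<noteq> []" "set p \<inter> W = {}" for v p
    proof -
      define m where "m = length p"
      define c where "c = cos (real m * \<theta>)"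
      define c' where "c' = cos (real (Suc m) * \<theta>)"
      have m: "m \<le> longest_path_length G" using vpath_length_le[OF p(1)] by (simp add: m_def)
      \<comment> \<open>\<open>c'\<close> vanishes when \<open>m\<close> is \<ell>, but then
        \<open>v # p\<close> is a longest path, no neighbour of \<open>v\<close> is left in
        \<open>W\<close>, and the sum over \<open>u\<close> is empty.\<close>
      have c: "0 < c" and c': "0 \<le> c'"
        using cos_pos[OF m] cos_nonneg[of "Suc m"] m by (auto simp: c_def c'_def)
      have vV: "v \<in> verts G" using psubset.prems v by auto
      have F: "0 < ?f (W - {v})" using v by (intro f_pos) auto
      have step: "q * c * ?f (W - {v, u}) \<le> c' * ?f (W - {v})" if u: "u \<in> nbrs G v \<inter> W" for u
      proof -
        have "v \<rightarrow>\<^bsub>G\<^esub> u" "u \<in> W" using u by auto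
        then have uv: "u \<rightarrow>\<^bsub>G\<^esub> v" "u \<noteq> v" using adj_commute[of v u] adj_irrefl[of v] by auto
        have 1: "vpath (u # v # p) G"
          using uv adj_in_verts(1)[OF uv(1)] p(1) disjoint_iff[THEN iffD1, OF p(3)] \<open>u \<in> W\<close>
          by (subst vpath_Cons_iff) auto
        have 2: "set (v # p) \<inter> (W - {v}) = {}" using p(3) by auto
        have 3: "W - {v} - {u} = W - {v, u}" by auto
        have 4: "W - {v} \<subset> W" "W - {v} \<subset> verts G" using v psubset.prems by auto
        have 5: "u \<in> W - {v}" "v # p \<noteq> []" using uv \<open>u \<in> W\<close> by auto
        note IH = conjunct2[OF psubset.IH[OF 4], rule_format]
        show ?thesis
          using IH[OF conjI[OF 5(1) conjI[OF 1 conjI[OF 5(2) 2]]]]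
          by (simp add: c_def c'_def m_def 3)
      qed
      \<comment> \<open>The previous path vertex \<open>hd p\<close> is a neighbour that is already
        gone, which lowers the degree bound \<open>q\<^sup>2 + 1\<close> to
        \<open>q\<^sup>2\<close>.\<close>
      have "hd p \<in> nbrs G v" "hd p \<notin> W"
        using p(1) vpath_Cons_iff[OF p(2)] hd_in_set[OF p(2)] p(3) by auto
      then have "nbrs G v \<inter> W \<subset> nbrs G v" by blast
      then have "card (nbrs G v \<inter> W) < vertex_degree G v"
        unfolding vertex_degree_eq_card_nbrs by (intro psubset_card_mono) auto
      then have card: "real (card (nbrs G v \<inter> W)) \<le> q\<^sup>2" using q(2)[OF vV] by linarith
      have "(\<Sum>u\<in>nbrs G v \<inter> W. q * c * ?f (W - {v, u})) \<le> real (card (nbrs G v \<inter> W)) * (c' * ?f (W - {v}))"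
        using step by (rule sum_bounded_above)
      also have "\<dots> \<le> q\<^sup>2 * (c' * ?f (W - {v}))"
        using card c' F by (intro mult_right_mono) auto
      finally have sum_le: "q * c * (\<Sum>u\<in>nbrs G v \<inter> W. ?f (W - {v, u})) \<le> q\<^sup>2 * c' * ?f (W - {v})"
        by (simp add: sum_distrib_left mult_ac)
      have "q * c * (2 * q * cos \<theta>) * ?f (W - {v})
          \<le> q * c * (x - real (vertex_degree G v)) * ?f (W - {v})"
        using q(1) c F x q(2)[OF vV] by (intro mult_right_mono mult_left_mono) auto
      moreover have "q * (c * ?f W) = q * c * (x - real (vertex_degree G v)) * ?f (W - {v})
          - q * c * (\<Sum>u\<in>nbrs G v \<inter> W. ?f (W - {v, u}))"
        by (simp add: poly_induced_lmp_recurrence[OF v psubset.hyps] algebra_simps)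
      ultimately have "q * c * (2 * q * cos \<theta>) * ?f (W - {v}) - q\<^sup>2 * c' * ?f (W - {v}) \<le> q * (c * ?f W)"
        using sum_le by linarith
      \<comment> \<open>The identity cos ((m - 1) \<theta>) + cos ((m + 1) \<theta>) = 2 cos
        \<theta> cos (m \<theta>) closes the induction.\<close>
      moreover have cos_m: "cos ((real m - 1) * \<theta>) = 2 * cos \<theta> * c - c'"
        by (simp add: c_def c'_def ring_distribs cos_add cos_diff)
      have "q * (q * cos ((real m - 1) * \<theta>) * ?f (W - {v}))
          = q * c * (2 * q * cos \<theta>) * ?f (W - {v}) - q\<^sup>2 * c' * ?f (W - {v})"
        unfolding cos_m by (simp add: algebra_simps power2_eq_square)
      ultimately have "q * (q * cos ((real m - 1) * \<theta>) * ?f (W - {v})) \<le> q * (c * ?f W)"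
        by linarith
      then show ?thesis using q(1) by (simp add: c_def m_def)
    qed
    have "0 < ?f W"
    proof (cases "W = {}")
      case False
      \<comment> \<open>With \<open>u\<close> outside \<open>W\<close>, the ratio bound applies to
        the deleted path \<open>[u]\<close> of length 1; the path \<open>[v, u]\<close> also shows
        \<ell> \<ge> 1, which makes cos \<theta> positive.\<close>
      then obtain v u where vu: "v \<in> W" "u \<in> verts G - W" "v \<rightarrow>\<^bsub>G\<^esub> u"
        using connected_imp_crossing[OF conn psubset.prems] by blast
      then have p: "vpath [v, u] G" using psubset.prems by (auto simp: vpath_def vwalk_def)
      then have "1 \<le> longest_path_length G" using vpath_length_le[OF p] by simp
      then have "0 < cos \<theta>" using cos_pos[of 1] by simp
      moreover have "q * ?f (W - {v}) \<le> cos \<theta> * ?f W" using ratio[OF vu(1) p] vu by simp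
      moreover have "0 < q * ?f (W - {v})" using vu q(1) by (intro mult_pos_pos f_pos) auto
      ultimately show ?thesis by (metis less_le_trans zero_less_mult_pos)
    qed (simp add: induced_lmp_empty)
    then show ?case
      using ratio by simp
  qed
qed

text \<open>All neighbours of \<open>v\<close> are still present, so the recurrence at
  \<open>v\<close> is combined with the ratio bound for each neighbour \<open>u\<close> after the
  deleted path \<open>[v]\<close>. The sign of the factor on the left later decides between
  strictness and equality.\<close>

lemma laplacian_matching_poly_lower_bound:
  fixes q \<theta> x :: real
  assumes conn: "connected G"
    and q: "0 < q" "\<And>v. v \<in> verts G \<Longrightarrow> real (vertex_degree G v) \<le> q\<^sup>2 + 1"
    and \<theta>: "(real (longest_path_length G) + 1) * \<theta> = pi / 2"
    and x: "q\<^sup>2 + 1 + 2 * q * cos \<theta> \<le> x"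
    and v: "v \<in> verts G"
  shows "(q * (x - real (vertex_degree G v)) - real (vertex_degree G v) * cos \<theta>)
      * poly (induced_lmp (verts G - {v})) x \<le> q * poly (laplacian_matching_poly G) x"
proof -
  let ?f = "\<lambda>U. poly (induced_lmp U) x"
  have sub: "verts G - {v} \<subset> verts G" using v by auto
  note ratio = induced_lmp_pos_ratio[OF conn q \<theta> x sub]
  have step: "q * ?f (verts G - {v, u}) \<le> cos \<theta> * ?f (verts G - {v})" if "u \<in> nbrs G v" for u
  proof -
    have "vpath [u, v] G" "u \<noteq> v"
      using that adj_commute[of v u] adj_irrefl[of v] adj_in_verts[of v u]
      by (auto simp: vpath_def vwalk_def)
    moreover have "verts G - {v} - {u} = verts G - {v, u}" by auto
    ultimately show ?thesis
      using conjunct2[OF ratio, rule_format, of u "[v]"] adj_in_verts(2)[of v u] that by simp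
  qed
  have nbrs_Int: "nbrs G v \<inter> verts G = nbrs G v" using nbrs_subset by blast
  have "(\<Sum>u\<in>nbrs G v. q * ?f (verts G - {v, u})) \<le> real (vertex_degree G v) * (cos \<theta> * ?f (verts G - {v}))"
    unfolding vertex_degree_eq_card_nbrs using step by (rule sum_bounded_above)
  moreover have "q * poly (laplacian_matching_poly G) x
      = q * (x - real (vertex_degree G v)) * ?f (verts G - {v})
        - (\<Sum>u\<in>nbrs G v. q * ?f (verts G - {v, u}))"
    using poly_induced_lmp_recurrence[OF v finite_verts, of x]
    by (simp add: induced_lmp_verts nbrs_Int right_diff_distrib sum_distrib_left mult.assoc)
  moreover have "(q * (x - real (vertex_degree G v)) - real (vertex_degree G v) * cos \<theta>) * ?f (verts G - {v})
      = q * (x - real (vertex_degree G v)) * ?f (verts G - {v})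
        - real (vertex_degree G v) * (cos \<theta> * ?f (verts G - {v}))"
    by (simp add: algebra_simps)
  ultimately show ?thesis by linarith
qed

text \<open>
  At the largest zero of all the polynomials \<open>induced_lmp U\<close> together, none of them is negative, so
  the recurrence propagates the zero from \<open>U\<close> to \<open>insert v U\<close>.
\<close>

lemma laplacian_matching_poly_has_root:
  assumes pos: "\<And>U x. U \<subseteq> verts G \<Longrightarrow> B \<le> x \<Longrightarrow> 0 < poly (induced_lmp U) x"
    and ne: "verts G \<noteq> {}"
  obtains r where "poly (laplacian_matching_poly G) r = 0"
proof -
  define Z where "Z = (\<Union>U\<in>Pow (verts G). {x. poly (induced_lmp U) x = 0})"
  have nz: "induced_lmp U \<noteq> 0" if "U \<subseteq> verts G" for U
    using pos[OF that, of B] by auto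
  then have "finite Z" unfolding Z_def by (intro finite_UN_I) (auto intro: poly_roots_finite)
  obtain a where a: "a \<in> verts G" using ne by blast
  \<comment> \<open>One vertex alone has its degree as a zero; this makes \<open>Z\<close> nonempty
    and its maximum \<open>t\<close> meaningful.\<close>
  have "nbrs G a \<inter> {a} = {}" using adj_irrefl by auto
  then have "poly (induced_lmp {a}) (real (vertex_degree G a)) = 0"
    by (subst poly_induced_lmp_recurrence[of a]) auto
  then have "Z \<noteq> {}" using a by (auto simp: Z_def)
  define t where "t = Max Z"
  have "t \<in> Z" unfolding t_def using \<open>finite Z\<close> \<open>Z \<noteq> {}\<close> by (rule Max_in)
  have nonneg: "0 \<le> poly (induced_lmp U) t" if U: "U \<subseteq> verts G" for U
  proof (rule ccontr)
    assume neg: "\<not> 0 \<le> poly (induced_lmp U) t"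
    \<comment> \<open>A negative value at \<open>t\<close> would give, by the intermediate value
      theorem up to \<open>B\<close>, a zero beyond the maximum \<open>t\<close>.\<close>
    then have "t < B" using pos[OF U, of t] by (meson less_le not_le_imp_less)
    then obtain y where "t < y" "poly (induced_lmp U) y = 0"
      using poly_IVT_pos[of t B "induced_lmp U"] neg pos[OF U, of B] by auto
    then have "y \<in> Z" using U by (auto simp: Z_def)
    then show False using Max_ge[OF \<open>finite Z\<close>] \<open>t < y\<close> by (fastforce simp: t_def)
  qed
  define \<U> where "\<U> = {U. U \<subseteq> verts G \<and> poly (induced_lmp U) t = 0}"
  have "finite \<U>" by (rule finite_subset[of _ "Pow (verts G)"]) (auto simp: \<U>_def)
  moreover have "\<U> \<noteq> {}" using \<open>t \<in> Z\<close> by (auto simp: Z_def \<U>_def)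
  ultimately obtain U where U: "U \<in> \<U>" and maximal: "\<And>U'. U' \<in> \<U> \<Longrightarrow> U \<subseteq> U' \<Longrightarrow> U = U'"
    using finite_has_maximal[of \<U>] by blast
  have "U = verts G"
  proof (rule ccontr)
    assume "U \<noteq> verts G"
    then obtain v where v: "v \<in> verts G" "v \<notin> U" using U by (auto simp: \<U>_def)
    have "finite U" using U by (auto simp: \<U>_def intro: finite_subset[OF _ finite_verts])
    have "poly (induced_lmp (insert v U)) t
        = - (\<Sum>u\<in>nbrs G v \<inter> insert v U. poly (induced_lmp (insert v U - {v, u})) t)"
      using U v \<open>finite U\<close> by (subst poly_induced_lmp_recurrence[of v]) (auto simp: \<U>_def)
    also have "\<dots> \<le> 0"
      using U v by (auto simp: \<U>_def intro!: sum_nonneg nonneg)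
    finally have "insert v U \<in> \<U>"
      using nonneg[of "insert v U"] U v by (auto simp: \<U>_def)
    then show False using maximal v by blast
  qed
  then show ?thesis using U that[of t] by (simp add: \<U>_def induced_lmp_verts)
qed

section \<open>Cycles\<close>

text \<open>The first vertex of a longest path has both neighbours on it, and one of them is not the
  second vertex. That one must be the last vertex, or it would have three neighbours; so the path
  closes up, no edge leaves it, and connectedness makes it spanning.\<close>

lemma is_cycle_graph_if_2_regular:
  assumes conn: "connected G" and ne: "verts G \<noteq> {}"
    and deg: "\<And>v. v \<in> verts G \<Longrightarrow> vertex_degree G v = 2"
  shows "is_cycle_graph G"
proof -
  obtain p where p: "vpath p G" and len: "length p = Suc (longest_path_length G)"
    using ex_longest_vpath[OF ne] .
  define n where "n = length p"
  have walk: "vwalk p G" and dist: "distinct p" and sub: "set p \<subseteq> verts G" and "p \<noteq> []"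
    using p by (auto simp: vpath_def vwalk_def)
  have card_nbrs: "card (nbrs G (p ! i)) = 2" if "i < n" for i
    using deg[of "p ! i"] subsetD[OF sub nth_mem, of i] that
    by (simp add: vertex_degree_eq_card_nbrs n_def)
  have path_adj: "p ! i \<rightarrow>\<^bsub>G\<^esub> p ! Suc i" "p ! Suc i \<rightarrow>\<^bsub>G\<^esub> p ! i" if "Suc i < n" for i
    using vwalk_nth_adj[OF walk, of i] adj_commute[of "p ! i" "p ! Suc i"] that by (auto simp: n_def)
  have nth_eq: "p ! i = p ! j \<longleftrightarrow> i = j" if "i < n" "j < n" for i j
    using nth_eq_iff_index_eq[OF dist] that by (simp add: n_def)
  have "0 < n" using \<open>p \<noteq> []\<close> by (simp add: n_def)
  \<comment> \<open>A neighbour off the path could be prepended to this longest path.\<close>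
  have nbrs_hd: "\<exists>j. 0 < j \<and> j < n \<and> u = p ! j" if u: "u \<in> nbrs G (p ! 0)" for u
  proof -
    have adj: "u \<rightarrow>\<^bsub>G\<^esub> p ! 0" "u \<noteq> p ! 0"
      using u adj_commute[of u "p ! 0"] adj_irrefl[of "p ! 0"] by auto
    have "u \<in> set p"
    proof (rule ccontr)
      assume "u \<notin> set p"
      then have "vpath (u # p) G"
        using adj adj_in_verts(1)[OF adj(1)] p \<open>p \<noteq> []\<close> by (simp add: vpath_Cons_iff hd_conv_nth)
      from vpath_length_le[OF this] show False using len by simp
    qed
    then obtain i where "i < length p" "u = p ! i" unfolding in_set_conv_nth by blast
    then show ?thesis using adj(2) by (intro exI[of _ i]) (auto simp: n_def intro: gr0I)
  qed
  obtain u w where uw: "nbrs G (p ! 0) = {u, w}" "u \<noteq> w"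
    using card_nbrs[OF \<open>0 < n\<close>] by (meson card_2_iff)
  have in_nbrs: "u \<in> nbrs G (p ! 0)" "w \<in> nbrs G (p ! 0)" unfolding uw(1) by simp_all
  obtain j where j: "0 < j" "j < n" "u = p ! j" using nbrs_hd[OF in_nbrs(1)] by blast
  obtain k where k: "0 < k" "k < n" "w = p ! k" using nbrs_hd[OF in_nbrs(2)] by blast
  \<comment> \<open>Index 1 can account for only one of the two neighbours.\<close>
  have "\<exists>j. 2 \<le> j \<and> j < n \<and> p ! 0 \<rightarrow>\<^bsub>G\<^esub> p ! j"
  proof (cases "j = 1")
    case True
    then have "2 \<le> k" using k j uw(2) by (cases "k = 1") auto
    then show ?thesis using k in_nbrs(2) by auto
  next
    case False
    then have "2 \<le> j" using j(1) by simp
    then show ?thesis using j in_nbrs(1) by auto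
  qed
  then obtain j where j: "2 \<le> j" "j < n" "p ! 0 \<rightarrow>\<^bsub>G\<^esub> p ! j" by blast
  then have j0: "p ! j \<rightarrow>\<^bsub>G\<^esub> p ! 0" using adj_commute[of "p ! 0" "p ! j"] by simp
  have j_last: "j = n - 1"
  proof (rule ccontr)
    assume "j \<noteq> n - 1"
    then have "Suc j < n" using j by simp
    \<comment> \<open>An interior \<open>j\<close> would be adjacent to both its path neighbours and
      to \<open>p ! 0\<close>; these differ because \<open>j \<ge> 2\<close>.\<close>
    then have "{p ! (j - 1), p ! Suc j, p ! 0} \<subseteq> nbrs G (p ! j)"
      using j j0 path_adj[of j] path_adj[of "j - 1"] by simp
    then have "card {p ! (j - 1), p ! Suc j, p ! 0} \<le> 2"
      using card_nbrs[OF j(2)] card_mono[OF finite_nbrs] by metis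
    moreover have "p ! (j - 1) \<noteq> p ! Suc j" "p ! (j - 1) \<noteq> p ! 0" "p ! Suc j \<noteq> p ! 0"
      using nth_eq[of "j - 1" "Suc j"] nth_eq[of "j - 1" 0] nth_eq[of "Suc j" 0] j \<open>Suc j < n\<close>
      by auto
    ultimately show False by simp
  qed
  have n3: "3 \<le> n" using j by simp
  \<comment> \<open>The cyclic predecessor; index 0 is split off because subtraction on naturals
    truncates.\<close>
  define prev where "prev i = (if i = 0 then n - 1 else i - 1)" for i
  have succ_adj: "p ! i \<rightarrow>\<^bsub>G\<^esub> p ! (Suc i mod n)" if "i < n" for i
    using that path_adj(1)[of i] j0 j_last by (cases "Suc i = n") auto
  have nbrs_nth: "nbrs G (p ! i) = {p ! (Suc i mod n), p ! prev i}" if i: "i < n" for i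
  proof -
    have prev: "prev i < n" "Suc (prev i) mod n = i"
      using i by (auto simp: prev_def)
    have "p ! i \<rightarrow>\<^bsub>G\<^esub> p ! prev i"
      using succ_adj[OF prev(1)] prev(2) adj_commute[of "p ! i" "p ! prev i"] by simp
    then have "{p ! (Suc i mod n), p ! prev i} \<subseteq> nbrs G (p ! i)"
      using succ_adj[OF i] by simp
    \<comment> \<open>On at least three vertices successor and predecessor differ, so together they
      exhaust the degree 2.\<close>
    moreover have "Suc i mod n \<noteq> prev i"
      using i n3 by (cases "Suc i = n") (auto simp: prev_def)
    then have "p ! (Suc i mod n) \<noteq> p ! prev i"
      using nth_eq[of "Suc i mod n" "prev i"] prev(1) n3 by simp
    then have "card {p ! (Suc i mod n), p ! prev i} = card (nbrs G (p ! i))"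
      using card_nbrs[OF i] by simp
    ultimately show ?thesis using card_subset_eq[OF finite_nbrs] by metis
  qed
  have closed: "u \<in> set p" if v: "v \<in> set p" and uv: "v \<rightarrow>\<^bsub>G\<^esub> u" for u v
  proof -
    obtain i where i: "i < n" "v = p ! i" using v unfolding in_set_conv_nth n_def by blast
    then have "u = p ! (Suc i mod n) \<or> u = p ! prev i" using nbrs_nth[OF i(1)] uv i(2) in_nbrs_iff[of u G v] by blast
    moreover have "Suc i mod n < n" "prev i < n" using n3 i by (auto simp: prev_def)
    ultimately show ?thesis unfolding n_def using nth_mem by blast
  qed
  have V: "verts G = set p"
  proof (rule ccontr)
    assume "verts G \<noteq> set p"
    with sub have "set p \<subset> verts G" by blast
    moreover have "set p \<noteq> {}" using \<open>p \<noteq> []\<close> by simp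
    ultimately obtain v u where "v \<in> set p" "u \<in> verts G - set p" "v \<rightarrow>\<^bsub>G\<^esub> u"
      by (rule connected_imp_crossing[OF conn])
    then show False using closed[of v u] by simp
  qed
  have "edges G = {{p ! i, p ! (Suc i mod n)} | i. i < n}"
  proof (intro equalityI subsetI)
    fix e assume "e \<in> edges G"
    then obtain v u where e: "e = {v, u}" "v \<rightarrow>\<^bsub>G\<^esub> u" unfolding edges_def by blast
    then have "v \<in> set p" using adj_in_verts(1) V by blast
    then obtain i where i: "i < n" "v = p ! i" unfolding in_set_conv_nth n_def by blast
    then have "u = p ! (Suc i mod n) \<or> u = p ! prev i" using nbrs_nth[OF i(1)] e(2) i(2) in_nbrs_iff[of u G v] by blast
    then show "e \<in> {{p ! i, p ! (Suc i mod n)} | i. i < n}"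
    proof
      assume "u = p ! prev i"
      moreover have "prev i < n" "Suc (prev i) mod n = i" using i by (auto simp: prev_def)
      ultimately have "e = {p ! prev i, p ! (Suc (prev i) mod n)}"
        using e(1) i(2) by (simp add: insert_commute)
      then show ?thesis using \<open>prev i < n\<close> by blast
    next
      assume "u = p ! (Suc i mod n)"
      then have "e = {p ! i, p ! (Suc i mod n)}" using e i by simp
      then show ?thesis using i(1) by blast
    qed
  next
    fix e assume "e \<in> {{p ! i, p ! (Suc i mod n)} | i. i < n}"
    then obtain i where "i < n" "e = {p ! i, p ! (Suc i mod n)}" by blast
    then show "e \<in> edges G" using succ_adj[of i] by (simp add: doubleton_in_edges_iff)
  qed
  then show ?thesis
    unfolding is_cycle_graph_def using dist n3 V by (intro exI[of _ p]) (simp add: n_def)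
qed

section \<open>Degrees, longest path and a zero of the polynomial of a cycle\<close>

context
  fixes vs :: "'a list"
  assumes dist: "distinct vs" and len: "3 \<le> length vs" and V: "verts G = set vs"
    and E: "edges G = {{vs ! i, vs ! (Suc i mod length vs)} | i. i < length vs}"
begin

lemma cycle_adj_iff:
  assumes "i < length vs" "j < length vs"
  shows "vs ! i \<rightarrow>\<^bsub>G\<^esub> vs ! j \<longleftrightarrow> j = Suc i mod length vs \<or> i = Suc j mod length vs"
proof -
  have nth_eq: "vs ! a = vs ! b \<longleftrightarrow> a = b" if "a < length vs" "b < length vs" for a b
    using nth_eq_iff_index_eq[OF dist] that by simp
  have lt: "Suc k mod length vs < length vs" for k using len by (intro mod_less_divisor) linarith
  have "vs ! i \<rightarrow>\<^bsub>G\<^esub> vs ! j \<longleftrightarrow> (\<exists>k<length vs. {vs ! i, vs ! j} = {vs ! k, vs ! (Suc k mod length vs)})"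
    unfolding doubleton_in_edges_iff[symmetric] E by blast
  also have "\<dots> \<longleftrightarrow> (\<exists>k<length vs. i = k \<and> j = Suc k mod length vs \<or> i = Suc k mod length vs \<and> j = k)"
    unfolding doubleton_eq_iff using nth_eq assms lt by metis
  finally show ?thesis using assms by blast
qed

lemma cycle_nbrs:
  assumes "i < length vs"
  shows "nbrs G (vs ! i) = {vs ! (Suc i mod length vs), vs ! (if i = 0 then length vs - 1 else i - 1)}"
    (is "_ = {_, vs ! ?k}")
proof -
  have k: "?k < length vs" "Suc ?k mod length vs = i" using assms by auto
  have uniq: "j = ?k" if "j < length vs" "i = Suc j mod length vs" for j
    using that assms by (cases "Suc j = length vs") auto
  have lt: "Suc i mod length vs < length vs" using len by (intro mod_less_divisor) linarith
  show ?thesis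
  proof (intro equalityI subsetI)
    fix u assume u: "u \<in> nbrs G (vs ! i)"
    then have "u \<in> set vs" using nbrs_subset V by blast
    then obtain j where j: "j < length vs" "u = vs ! j" by (metis in_set_conv_nth)
    then have "j = Suc i mod length vs \<or> i = Suc j mod length vs"
      using u cycle_adj_iff[OF assms j(1)] by simp
    then show "u \<in> {vs ! (Suc i mod length vs), vs ! ?k}"
    proof
      assume "i = Suc j mod length vs"
      from uniq[OF j(1) this] show ?thesis unfolding j(2) by (simp only: insert_iff simp_thms)
    qed (simp add: j(2))
  next
    fix u assume "u \<in> {vs ! (Suc i mod length vs), vs ! ?k}"
    then show "u \<in> nbrs G (vs ! i)"
      using cycle_adj_iff[OF assms lt] cycle_adj_iff[OF assms k(1)] k(2) by auto
  qed
qed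

lemma cycle_degree:
  assumes "v \<in> verts G"
  shows "vertex_degree G v = 2"
proof -
  obtain i where i: "i < length vs" "v = vs ! i" using assms V by (metis in_set_conv_nth)
  let ?k = "if i = 0 then length vs - 1 else i - 1"
  have "Suc i mod length vs \<noteq> ?k" "Suc i mod length vs < length vs" "?k < length vs"
    using i len by (cases "Suc i = length vs"; auto)+
  then have "vs ! (Suc i mod length vs) \<noteq> vs ! ?k"
    using nth_eq_iff_index_eq[OF dist] by blast
  then show ?thesis by (simp add: vertex_degree_eq_card_nbrs i(2) cycle_nbrs[OF i(1)])
qed

text \<open>Omitting one edge leaves a path through all vertices, and no path has more vertices than
  the graph. This turns 2 \<ell> + 2 into twice the cycle length.\<close>

lemma cycle_longest_path: "Suc (longest_path_length G) = length vs"
proof (rule antisym)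
  have "vs \<noteq> []" using len by (cases vs) auto
  have "vpath vs G"
  proof (rule vpathI[OF vwalkI_nth dist])
    fix i assume "Suc i < length vs"
    then show "vs ! i \<rightarrow>\<^bsub>G\<^esub> vs ! Suc i" using cycle_adj_iff[of i "Suc i"] by simp
  qed (use V \<open>vs \<noteq> []\<close> in auto)
  then show "length vs \<le> Suc (longest_path_length G)" by (rule vpath_length_le)
next
  have "verts G \<noteq> {}" using V len by (cases vs) auto
  then obtain p where p: "vpath p G" "length p = Suc (longest_path_length G)"
    by (rule ex_longest_vpath)
  then have "distinct p" "set p \<subseteq> set vs" using V by (auto simp: vpath_def vwalk_def)
  then have "length p \<le> card (set vs)" by (metis card_mono distinct_card finite_set)
  with p show "Suc (longest_path_length G) \<le> length vs" by (simp add: distinct_card dist)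
qed

lemma arc_Diff_last: "nth vs ` {a..<Suc b} - {vs ! b} = nth vs ` {a..<b}" if "b < length vs"
proof -
  have "inj_on (nth vs) {..<length vs}" using dist inj_on_nth by blast
  then have "nth vs ` ({a..<Suc b} - {b}) = nth vs ` {a..<Suc b} - nth vs ` {b}"
    by (rule inj_on_image_set_diff) (use that in auto)
  moreover have "{a..<Suc b} - {b} = {a..<b}" by auto
  ultimately show ?thesis by simp
qed

text \<open>\<open>sin ((k + 1) \<theta>) / sin \<theta>\<close> is the Chebyshev polynomial of the second kind in \<open>cos \<theta>\<close>.\<close>

lemma sin_mult_poly_induced_lmp_arc:
  assumes "a + k < length vs"
  shows "sin \<theta> * poly (induced_lmp (nth vs ` {a..<a + k})) (2 + 2 * cos \<theta>) = sin (real (Suc k) * \<theta>)"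
  using assms
proof (induction k rule: less_induct)
  case (less k)
  let ?x = "2 + 2 * cos \<theta>"
  let ?A = "\<lambda>k. nth vs ` {a..<a + k}"
  have trig: "sin (real (Suc (Suc m)) * \<theta>) = 2 * cos \<theta> * sin (real (Suc m) * \<theta>) - sin (real m * \<theta>)" for m
  proof -
    have "sin (real (Suc m) * \<theta> + \<theta>) + sin (real (Suc m) * \<theta> - \<theta>) = 2 * cos \<theta> * sin (real (Suc m) * \<theta>)"
      unfolding sin_add sin_diff by simp
    moreover have "real (Suc m) * \<theta> + \<theta> = real (Suc (Suc m)) * \<theta>" "real (Suc m) * \<theta> - \<theta> = real m * \<theta>"
      by (simp_all add: algebra_simps)
    ultimately show ?thesis by simp
  qed
  show ?case
  proof (cases k)
    case 0
    then show ?thesis by (simp add: induced_lmp_empty)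
  next
    case (Suc m)
    define b where "b = a + m"
    \<comment> \<open>\<open>b\<close> is the last index of the arc; by
      \<open>a + k < length vs\<close> its successor does not wrap around and lies outside the
      arc.\<close>
    have b: "Suc b < length vs" "b < length vs" using less.prems Suc by (auto simp: b_def)
    have A: "?A k = nth vs ` {a..<Suc b}" "?A m = nth vs ` {a..<b}" by (auto simp: Suc b_def)
    have in_A: "vs ! i \<in> ?A k \<longleftrightarrow> a \<le> i \<and> i \<le> b" if "i < length vs" for i
      unfolding A(1) using nth_eq_iff_index_eq[OF dist] that b by (auto simp: image_iff)
    have deg: "vertex_degree G (vs ! b) = 2" using cycle_degree V b by simp
    have rec: "poly (induced_lmp (?A k)) ?x = 2 * cos \<theta> * poly (induced_lmp (?A m)) ?x
        - (\<Sum>u\<in>nbrs G (vs ! b) \<inter> ?A k. poly (induced_lmp (?A m - {u})) ?x)"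
    proof -
      have "?A k - {vs ! b, u} = ?A m - {u}" for u
        unfolding A arc_Diff_last[OF b(2), symmetric] by auto
      moreover have "?A k - {vs ! b} = ?A m" unfolding A using arc_Diff_last[OF b(2)] .
      ultimately show ?thesis
        using poly_induced_lmp_recurrence[of "vs ! b" "?A k" ?x] in_A[OF b(2)] deg
        by (simp add: b_def)
    qed
    have next_notin: "vs ! Suc b \<notin> ?A k" using in_A[OF b(1)] by simp
    show ?thesis
    proof (cases m)
      case 0
      \<comment> \<open>The arc is a single vertex, so its cyclic predecessor, possibly at the end
        of the list, lies outside too.\<close>
      let ?p = "if b = 0 then length vs - 1 else b - 1"
      have p: "?p < length vs" "\<not> (a \<le> ?p \<and> ?p \<le> b)" using b 0 len by (auto simp: b_def)
      have "vs ! ?p \<notin> ?A k" using in_A[OF p(1)] p(2) by blast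
      then have "nbrs G (vs ! b) \<inter> ?A k = {}"
        using cycle_nbrs[OF b(2)] next_notin b by auto
      then show ?thesis using rec trig[of 0] Suc 0 by (simp add: induced_lmp_empty)
    next
      case (Suc l)
      have l: "b - 1 = a + l" "b \<noteq> 0" "b = Suc (a + l)" using Suc by (auto simp: b_def)
      have "vs ! (a + l) \<in> ?A k" using in_A[of "a + l"] b l by simp
      then have "nbrs G (vs ! b) \<inter> ?A k = {vs ! (a + l)}"
        using cycle_nbrs[OF b(2)] next_notin b l by auto
      moreover have "?A m - {vs ! (a + l)} = ?A l"
        unfolding A using arc_Diff_last[of "a + l" a] b l by simp
      ultimately have "sin \<theta> * poly (induced_lmp (?A k)) ?x
          = 2 * cos \<theta> * (sin \<theta> * poly (induced_lmp (?A m)) ?x) - sin \<theta> * poly (induced_lmp (?A l)) ?x"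
        by (simp add: rec right_diff_distrib mult.left_commute)
      also have "\<dots> = 2 * cos \<theta> * sin (real (Suc m) * \<theta>) - sin (real (Suc l) * \<theta>)"
        using less.IH[of m] less.IH[of l] less.prems \<open>k = Suc m\<close> Suc by simp
      also have "\<dots> = sin (real (Suc k) * \<theta>)"
        using trig[of m] \<open>k = Suc m\<close> Suc by simp
      finally show ?thesis .
    qed
  qed
qed

text \<open>Let N be the number of vertices. Deleting one vertex leaves an arc of N - 1 vertices,
  deleting it with either neighbour an arc of N - 2. Hence sin \<theta> times the polynomial is 2
  cos \<theta> sin (N \<theta>) - 2 sin ((N - 1) \<theta>) = 2 sin \<theta> cos (N \<theta>), which
  vanishes for N \<theta> = pi / 2.\<close>

lemma cycle_root:
  assumes "\<theta> = pi / (2 * real (length vs))"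
  shows "poly (laplacian_matching_poly G) (2 + 2 * cos \<theta>) = 0"
proof -
  let ?x = "2 + 2 * cos \<theta>"
  let ?A = "\<lambda>a k. nth vs ` {a..<a + k}"
  obtain n where n: "length vs = Suc (Suc n)" "1 \<le> n"
    using len by (metis Suc_le_D Suc_le_mono numeral_3_eq_3 One_nat_def)
  let ?v = "vs ! Suc n"
  have V_arc: "verts G = ?A 0 (Suc (Suc n))"
    using V n by (metis add_0 atLeast0LessThan nth_image order_refl take_all_iff lessThan_atLeast0)
  have v: "?v \<in> verts G" using V n by simp
  have Diff1: "verts G - {?v} = ?A 0 (Suc n)"
    using arc_Diff_last[of "Suc n" 0] n V_arc by simp
  have Diff2: "verts G - {?v, vs ! n} = ?A 0 n"
  proof -
    have "verts G - {?v, vs ! n} = verts G - {?v} - {vs ! n}" by auto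
    then show ?thesis unfolding Diff1 using arc_Diff_last[of n 0] n by simp
  qed
  \<comment> \<open>This arc starts at index 1, the reason for the free start \<open>a\<close> in
    the formula for arcs.\<close>
  have Diff3: "verts G - {?v, vs ! 0} = ?A 1 n"
  proof -
    have "vs ! 0 \<notin> ?A 1 n" using nth_eq_iff_index_eq[OF dist] n by (auto simp: image_iff)
    moreover have "{0..<0 + Suc n} = insert 0 {1..<1 + n}" by auto
    then have "verts G - {?v} = insert (vs ! 0) (?A 1 n)"
      unfolding Diff1 by (simp only: image_insert)
    then have "verts G - {?v, vs ! 0} = insert (vs ! 0) (?A 1 n) - {vs ! 0}" by auto
    ultimately show ?thesis by simp
  qed
  have nbrs: "nbrs G ?v = {vs ! 0, vs ! n}" using cycle_nbrs[of "Suc n"] n by simp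
  have "vs ! 0 \<noteq> vs ! n" using nth_eq_iff_index_eq[OF dist, of 0 n] n by auto
  moreover have "nbrs G ?v \<inter> verts G = {vs ! 0, vs ! n}" using nbrs V n by auto
  ultimately have "poly (laplacian_matching_poly G) ?x
      = 2 * cos \<theta> * poly (induced_lmp (?A 0 (Suc n))) ?x
        - poly (induced_lmp (?A 1 n)) ?x - poly (induced_lmp (?A 0 n)) ?x"
    using poly_induced_lmp_recurrence[OF v finite_verts, of ?x] Diff1 Diff2 Diff3 cycle_degree[OF v]
    by (simp add: induced_lmp_verts)
  then have "sin \<theta> * poly (laplacian_matching_poly G) ?x
      = 2 * cos \<theta> * (sin \<theta> * poly (induced_lmp (?A 0 (Suc n))) ?x)
        - sin \<theta> * poly (induced_lmp (?A 1 n)) ?x - sin \<theta> * poly (induced_lmp (?A 0 n)) ?x"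
    by (simp add: right_diff_distrib mult_ac)
  also have "\<dots> = 2 * cos \<theta> * sin (real (Suc (Suc n)) * \<theta>) - 2 * sin (real (Suc n) * \<theta>)"
    using sin_mult_poly_induced_lmp_arc[of 0 "Suc n" \<theta>] sin_mult_poly_induced_lmp_arc[of 1 n \<theta>]
      sin_mult_poly_induced_lmp_arc[of 0 n \<theta>] n by simp
  also have "real (Suc n) * \<theta> = real (Suc (Suc n)) * \<theta> - \<theta>" by (simp add: algebra_simps)
  also have "real (Suc (Suc n)) * \<theta> = pi / 2"
    using assms n(1) by (simp add: field_simps)
  also have "2 * cos \<theta> * sin (pi / 2) - 2 * sin (pi / 2 - \<theta>) = 0" by (simp add: sin_diff)
  finally have "sin \<theta> * poly (laplacian_matching_poly G) ?x = 0" .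
  moreover have "0 < sin \<theta>"
  proof (rule sin_gt_zero)
    show "0 < \<theta>" using assms n(1) by simp
    have "pi * 1 < pi * (2 * real (length vs))" using n(1) by (intro mult_strict_left_mono) auto
    then show "\<theta> < pi" using assms n(1) by (simp add: divide_less_eq)
  qed
  ultimately show ?thesis by simp
qed

end

end

section \<open>The bound, its strictness and the case of equality\<close>

theorem theorem3p7:
  fixes G :: "('a, 'b) pre_digraph"
  assumes "graph G"
    and "Digraph_Component.connected G"
    and "max_degree G \<ge> 2"
  shows "largest_zero (laplacian_matching_poly G)
           \<le> real (max_degree G) + 2 * sqrt (real (max_degree G) - 1)
               * cos (pi / (2 * real (longest_path_length G) + 2))
       \<and> (largest_zero (laplacian_matching_poly G)
           = real (max_degree G) + 2 * sqrt (real (max_degree G) - 1)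
               * cos (pi / (2 * real (longest_path_length G) + 2))
         \<longleftrightarrow> is_cycle_graph G)"
proof -
  interpret graph G by fact
  define q where "q = sqrt (real (max_degree G) - 1)"
  define \<theta> where "\<theta> = pi / (2 * real (longest_path_length G) + 2)"
  define B where "B = real (max_degree G) + 2 * q * cos \<theta>"
  let ?f = "laplacian_matching_poly G"
  have q2: "q\<^sup>2 + 1 = real (max_degree G)" using assms(3) by (simp add: q_def)
  have q: "0 < q" using assms(3) by (simp add: q_def)
  have deg_le: "real (vertex_degree G v) \<le> q\<^sup>2 + 1" if "v \<in> verts G" for v
    using vertex_degree_le_max_degree[OF that] q2 by simp
  have \<theta>: "(real (longest_path_length G) + 1) * \<theta> = pi / 2"
    by (simp add: \<theta>_def field_simps)
  have ne: "verts G \<noteq> {}"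
    using assms(2) unfolding connected_def strongly_connected_def
    by (metis pverts_mk_symmetric with_proj_simps(1))
  then obtain v0 where v0: "v0 \<in> verts G" "vertex_degree G v0 = max_degree G"
    unfolding max_degree_def by (metis (mono_tags) Max_in finite_imageI finite_verts image_iff image_is_empty)
  \<comment> \<open>There is an edge, hence \<ell> \<ge> 1 and \<theta> < pi / 2; the positive
    cosine is used for strictness below.\<close>
  have "nbrs G v0 \<noteq> {}" using v0(2) assms(3) by (auto simp: vertex_degree_eq_card_nbrs)
  then obtain u where u: "v0 \<rightarrow>\<^bsub>G\<^esub> u" by auto
  then have "vpath [v0, u] G"
    using adj_irrefl[of v0] adj_in_verts[OF u] by (auto simp: vpath_def vwalk_def)
  then have l: "1 \<le> longest_path_length G" using vpath_length_le by fastforce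
  have cos: "0 < cos \<theta>"
  proof (rule cos_gt_zero)
    show "0 < \<theta>" by (simp add: \<theta>_def)
    show "\<theta> < pi / 2" using l by (simp add: \<theta>_def field_simps)
  qed
  have x: "q\<^sup>2 + 1 + 2 * q * cos \<theta> \<le> x" if "B \<le> x" for x using that q2 by (simp add: B_def)
  have pos_proper: "0 < poly (induced_lmp U) x" if "U \<subset> verts G" "B \<le> x" for U x
    using induced_lmp_pos_ratio[OF assms(2) q deg_le \<theta> x[OF that(2)] that(1)] by blast
  \<comment> \<open>Given \<open>B \<le> x\<close>, the condition \<open>strict\<close> fails
    exactly when \<open>x\<close> is \<open>B\<close>, \<open>v\<close> has degree 2 and \<Delta> is
    2, as on a cycle.\<close>
  have pos: "0 < poly ?f x"
    if x_ge: "B \<le> x" and v: "v \<in> verts G" and strict: "B < x \<or> vertex_degree G v \<noteq> 2 \<or> max_degree G \<noteq> 2" for x v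
  proof -
    define d where "d = real (vertex_degree G v)"
    define D where "D = real (max_degree G)"
    have d: "d \<le> D" using vertex_degree_le_max_degree[OF v] by (simp add: d_def D_def)
    have D: "2 \<le> D" "q * q = D - 1" using assms(3) q2 by (auto simp: D_def power2_eq_square)
    \<comment> \<open>By \<open>q * q = D - 1\<close> the factor splits into three nonnegative
      terms, one for each source of slack: \<open>x\<close> beyond \<open>B\<close>,
      \<open>d\<close> below \<open>D\<close>, and \<open>D\<close> above 2. The last one rests on
      \<open>d \<le> D \<le> 2 * (D - 1)\<close>.\<close>
    have "q * (x - d) - d * cos \<theta> = q * (x - B) + q * (D - d) + (2 * (D - 1) - d) * cos \<theta>"
      unfolding D(2)[symmetric] B_def D_def[symmetric] by (simp add: algebra_simps)
    moreover have "0 \<le> q * (x - B)" "0 \<le> q * (D - d)" "0 \<le> (2 * (D - 1) - d) * cos \<theta>"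
      using q x_ge d D cos by auto
    moreover have "0 < q * (x - B) \<or> 0 < q * (D - d) \<or> 0 < (2 * (D - 1) - d) * cos \<theta>"
    proof -
      have "B < x \<or> d < D \<or> 2 < D"
        using strict d D(1) unfolding d_def D_def by linarith
      then show ?thesis using q cos d D(1) by auto
    qed
    ultimately have "0 < q * (x - d) - d * cos \<theta>" by linarith
    moreover have "0 < poly (induced_lmp (verts G - {v})) x" using v x_ge by (intro pos_proper) auto
    ultimately have "0 < q * poly ?f x"
      using laplacian_matching_poly_lower_bound[OF assms(2) q deg_le \<theta> x[OF x_ge] v]
        mult_pos_pos unfolding d_def by (meson less_le_trans)
    then show ?thesis using q by (simp add: zero_less_mult_iff)
  qed
  \<comment> \<open>\<open>largest_zero\<close> is meaningful only once a zero is known to exist.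
    The threshold is \<open>B + 1\<close> because the polynomial of the whole graph may vanish at
    \<open>B\<close>.\<close>
  have "0 < poly (induced_lmp U) x" if "U \<subseteq> verts G" "B + 1 \<le> x" for U x
    using that pos[of x v0] v0(1) pos_proper[of U x] by (cases "U = verts G") (auto simp: induced_lmp_verts)
  then obtain r where r: "poly ?f r = 0"
    using laplacian_matching_poly_has_root[OF _ ne] by metis
  have "?f \<noteq> 0" using pos[of "B + 1" v0] v0(1) by auto
  then have fin: "finite {x. poly ?f x = 0}" by (rule poly_roots_finite)
  define L where "L = largest_zero ?f"
  have root: "poly ?f L = 0"
    using Max_in[OF fin] r unfolding L_def largest_zero_def by blast
  have L_ge: "y \<le> L" if "poly ?f y = 0" for y
    unfolding L_def largest_zero_def using fin that by (intro Max_ge) auto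
  have L_le: "L \<le> B"
  proof (rule ccontr)
    assume "\<not> L \<le> B"
    then show False using pos[of L v0] v0(1) root by simp
  qed
  have "L = B \<longleftrightarrow> is_cycle_graph G"
  proof
    assume "L = B"
    \<comment> \<open>As \<open>B\<close> is a zero, \<open>strict\<close> must fail at every
      vertex.\<close>
    then have "max_degree G = 2 \<and> (\<forall>v\<in>verts G. vertex_degree G v = 2)"
      using pos[of B] root v0(1) by force
    then show "is_cycle_graph G" using is_cycle_graph_if_2_regular[OF assms(2) ne] by blast
  next
    assume "is_cycle_graph G"
    then obtain vs where vs: "distinct vs" "3 \<le> length vs" "verts G = set vs"
      "edges G = {{vs ! i, vs ! (Suc i mod length vs)} | i. i < length vs}"
      unfolding is_cycle_graph_def by blast
    \<comment> \<open>For a cycle \<open>q\<close> is 1 and \<theta> is the angle of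
      \<open>cycle_root\<close>, so the upper bound \<open>B\<close> is itself a zero.\<close>
    have "max_degree G = 2" using cycle_degree[OF vs v0(1)] v0(2) by simp
    moreover have "\<theta> = pi / (2 * real (length vs))"
      unfolding \<theta>_def cycle_longest_path[OF vs, symmetric] by (simp add: algebra_simps)
    ultimately have "poly ?f B = 0"
      using cycle_root[OF vs] by (simp add: B_def q_def)
    then show "L = B" using L_ge L_le by (simp add: order_antisym)
  qed
  with L_le show ?thesis by (simp add: L_def B_def q_def \<theta>_def)
qed

end
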